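(* Let $(X,d)$ and $(Y,\varrho)$ be metric spaces, let $F:X\rightrightarrows Y$ be a set-valued mapping and let $(\bar x,\bar y)\in \mathrm{gph}\,F$. Then: (i) $\displaystyle \mathrm{lopen}\,F(\bar x,\bar y)\ \ge\ \liminf_{(x,y)\to(\bar x,\bar y),\ y\in F(x)} \mathrm{lopen}\,F(x,y)\ \ge\ \mathrm{sur}\,F(\bar x,\bar y)$. (ii) Suppose that $X$ and $Y$ are normed spaces and that $F$ has a locally star-shaped graph at $(\bar x,\bar y)$, that is, there is $a\in(0,1]$ such that $(1-t)(\bar x,\bar y)+t\,\mathrm{gph}\,F\subset \mathrm{gph}\,F$ for each $t\in[0,a]$. If there are positive constants $\alpha$ and $\beta$ such that $\mathbb{B}[\bar y,\beta]\subset F(\mathbb{B}[\bar x,\alpha])$, then $\mathrm{lopen}\,F(\bar x,\bar y)\ge \beta/\alpha$. (iii) If $X$ and $Y$ are normed spaces and $F$ has a convex graph, then $\mathrm{lopen}\,F(\bar x,\bar y)=\mathrm{sur}\,F(\bar x,\bar y)$. (iv) If $X$ and $Y$ are Banach spaces and $F$ is a closed convex process, that is, $\mathrm{gph}\,F$ is a closed convex cone in $X\times Y$, then $$\mathrm{lopen}\,F(0,0)=\mathrm{sur}\,F(0,0)=\sup\{\varrho>0:\ F(\mathbb{B}_X)\supset\varrho\,\mathbb{B}_Y\}=\inf\{\|x^*\|:\ x^*\in F^*(\mathbb{S}_{Y^*})\},$$ where $F^*:Y^*\rightrightarrows X^*$ is the adjoint process to $F$ defined by $$F^*(y^* )=\{x^*\in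 X^*:\ \langle x^*,x\rangle\le\langle y^*,y\rangle\ \text{ for each } (x,y)\in\mathrm{gph}\,F\}.$$
   Context: A set-valued mapping $F:X\rightrightarrows Y$ assigns to each $x\in X$ a (possibly empty) subset $F(x)$ of $Y$; $\mathrm{gph}\,F=\{(x,y)\in X\times Y: y\in F(x)\}$; $F(C)=\bigcup_{x\in C}F(x)$. $\mathbb{B}[u,r]$ is the closed ball and $\mathbb{B}(u,r)$ the open ball with centre $u$ and radius $r>0$. In a normed space $Z$, $\mathbb{B}_Z$ and $\mathbb{S}_Z$ are the closed unit ball and the unit sphere; $X^*$ and $Y^*$ are the dual spaces of $X$ and $Y$. In part (iv), the letter $\varrho$ inside the supremum denotes a positive number, not the metric of $Y$. Modulus of openness at a point: $\mathrm{lopen}\,F(\bar x,\bar y)$, for $\bar y\in F(\bar x)$, is the supremum of all $c>0$ for which there is $\varepsilon>0$ such that $\mathbb{B}[\bar y,ct]\subset F(\mathbb{B}[\bar x,t])$ for each $t\in(0,\varepsilon)$. Modulus of surjection (around a point): $\mathrm{sur}\,F(\bar x,\bar y)$, for $\bar y\in F(\bar x)$, is the supremum of all $c>0$ for which there are $\varepsilon>0$ and a neighborhood $U\times V$ of $(\bar x,\bar y)$ in $X\times Y$ such that $\mathbb{B}[y,ct]\subset F(\mathbb{B}[x,t])$ whenever $(x,y)\in U\times V$, $y\in F(x)$ and $t\in(0,\varepsilon)$. Conventions: $\sup\emptyset=0$ and $\inf\emptyset=\infty$; both moduli take values in $[0,\infty]$. The limes inferior includes the reference point itself, i.e. $\liminf_{(x,y)\to(\bar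 x,\bar y),\,y\in F(x)}\mathrm{lopen}\,F(x,y)=\sup_{r>0}\inf\{\mathrm{lopen}\,F(x,y): (x,y)\in\mathrm{gph}\,F\cap(\mathbb{B}(\bar x,r)\times\mathbb{B}(\bar y,r))\}$. *)

theory Defs
  imports "HOL-Analysis.Analysis"
begin

text \<open>Set-valued mappings \<open>X \<rightrightarrows> Y\<close> are functions into sets; the image \<open>F(C)\<close> is
  written \<open>\<Union>x\<in>C. F x\<close>. Moduli take values in \<^typ>\<open>ennreal\<close>, where \<open>Sup {} = 0\<close> and
  \<open>Inf {} = \<infinity>\<close>.\<close>

definition gph :: "('a \<Rightarrow> 'b set) \<Rightarrow> ('a \<times> 'b) set" where
  "gph F = {(x, y). y \<in> F x}"

text \<open>The moduli are meaningful only at points \<open>(x, y)\<close> of the graph; their values elsewhere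
  are irrelevant.\<close>

definition lopen :: "('a::metric_space \<Rightarrow> 'b::metric_space set) \<Rightarrow> 'a \<Rightarrow> 'b \<Rightarrow> ennreal" where
  "lopen F x y = Sup {ennreal c | c. c > 0 \<and>
     (\<exists>\<epsilon>>0. \<forall>t\<in>{0<..<\<epsilon>}. cball y (c * t) \<subseteq> (\<Union>u\<in>cball x t. F u))}"

definition sur :: "('a::metric_space \<Rightarrow> 'b::metric_space set) \<Rightarrow> 'a \<Rightarrow> 'b \<Rightarrow> ennreal" where
  "sur F x y = Sup {ennreal c | c. c > 0 \<and>
     (\<exists>\<epsilon>>0. \<exists>U V. open U \<and> x \<in> U \<and> open V \<and> y \<in> V \<and>
        (\<forall>x'\<in>U. \<forall>y'\<in>V. \<forall>t\<in>{0<..<\<epsilon>}. y' \<in> F x' \<longrightarrow>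
           cball y' (c * t) \<subseteq> (\<Union>u\<in>cball x' t. F u)))}"

text \<open>Limes inferior along the graph, with the reference point included.\<close>

definition liminf_gph ::
  "('a::metric_space \<Rightarrow> 'b::metric_space set) \<Rightarrow> ('a \<Rightarrow> 'b \<Rightarrow> ennreal) \<Rightarrow> 'a \<Rightarrow> 'b \<Rightarrow> ennreal" where
  "liminf_gph F f x y =
     (SUP r\<in>{0<..}. INF (u, v)\<in>gph F \<inter> (ball x r \<times> ball y r). f u v)"

lemma liminf_gph_eq_Liminf:
  "liminf_gph F f x y = Liminf (inf (nhds (x, y)) (principal (gph F))) (\<lambda>(u, v). f u v)"
proof (rule antisym)
  show "liminf_gph F f x y \<le> Liminf (inf (nhds (x, y)) (principal (gph F))) (\<lambda>(u, v). f u v)"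
    unfolding liminf_gph_def
  proof (rule SUP_least)
    fix r :: real assume "r \<in> {0<..}"
    then have "open (ball x r \<times> ball y r)" "(x, y) \<in> ball x r \<times> ball y r"
      by (auto intro: open_Times)
    then have "eventually (\<lambda>p. p \<in> ball x r \<times> ball y r) (nhds (x, y))"
      by (rule eventually_nhds_in_open)
    then have "eventually (\<lambda>p. p \<in> gph F \<inter> (ball x r \<times> ball y r))
        (inf (nhds (x, y)) (principal (gph F)))"
      unfolding eventually_inf_principal by (rule eventually_mono) auto
    then have "(INF p\<in>Collect (\<lambda>p. p \<in> gph F \<inter> (ball x r \<times> ball y r)). (\<lambda>(u, v). f u v) p)
        \<le> Liminf (inf (nhds (x, y)) (principal (gph F))) (\<lambda>(u, v). f u v)"
      unfolding Liminf_def by (intro SUP_upper) simp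
    then show "(INF (u, v)\<in>gph F \<inter> (ball x r \<times> ball y r). f u v)
        \<le> Liminf (inf (nhds (x, y)) (principal (gph F))) (\<lambda>(u, v). f u v)"
      unfolding Collect_mem_eq .
  qed
next
  show "Liminf (inf (nhds (x, y)) (principal (gph F))) (\<lambda>(u, v). f u v) \<le> liminf_gph F f x y"
    unfolding Liminf_def
  proof (rule SUP_least)
    fix P assume "P \<in> {P. eventually P (inf (nhds (x, y)) (principal (gph F)))}"
    then obtain S where S: "open S" "(x, y) \<in> S" "\<And>p. p \<in> S \<Longrightarrow> p \<in> gph F \<Longrightarrow> P p"
      by (auto simp: eventually_inf_principal eventually_nhds)
    obtain A B where "open A" "open B" "(x, y) \<in> A \<times> B" "A \<times> B \<subseteq> S"
      using open_prod_elim[OF S(1,2)] .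
    with S(3) have AB: "open A" "x \<in> A" "open B" "y \<in> B"
        "\<And>u v. u \<in> A \<Longrightarrow> v \<in> B \<Longrightarrow> (u, v) \<in> gph F \<Longrightarrow> P (u, v)"
      by auto
    obtain r s where r: "r > 0" "ball x r \<subseteq> A" and s: "s > 0" "ball y s \<subseteq> B"
      using AB open_contains_ball by metis
    have "(INF p\<in>Collect P. (\<lambda>(u, v). f u v) p)
        \<le> (INF (u, v)\<in>gph F \<inter> (ball x (min r s) \<times> ball y (min r s)). f u v)"
      using r s AB(5) by (intro INF_superset_mono) (auto simp: subset_iff)
    also have "\<dots> \<le> liminf_gph F f x y"
      unfolding liminf_gph_def using r s by (intro SUP_upper) auto
    finally show "(INF p\<in>Collect P. (\<lambda>(u, v). f u v) p) \<le> liminf_gph F f x y" .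
  qed
qed

definition locally_starshaped_graph ::
  "('a::real_normed_vector \<Rightarrow> 'b::real_normed_vector set) \<Rightarrow> 'a \<Rightarrow> 'b \<Rightarrow> bool" where
  "locally_starshaped_graph F x y \<longleftrightarrow>
     (\<exists>a. 0 < a \<and> a \<le> 1 \<and>
       (\<forall>t\<in>{0..a}. (\<lambda>p. (1 - t) *\<^sub>R (x, y) + t *\<^sub>R p) ` gph F \<subseteq> gph F))"

text \<open>\<^const>\<open>convex_cone\<close> includes nonemptiness, so that \<open>(0, 0)\<close> belongs to the graph.\<close>

definition closed_convex_process ::
  "('a::real_normed_vector \<Rightarrow> 'b::real_normed_vector set) \<Rightarrow> bool" where
  "closed_convex_process F \<longleftrightarrow> closed (gph F) \<and> convex_cone (gph F)"

definition adjoint_process ::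
  "('a::real_normed_vector \<Rightarrow> 'b::real_normed_vector set) \<Rightarrow>
     ('b \<Rightarrow>\<^sub>L real) \<Rightarrow> ('a \<Rightarrow>\<^sub>L real) set" where
  "adjoint_process F ystar =
     {xstar. \<forall>(x, y)\<in>gph F. blinfun_apply xstar x \<le> blinfun_apply ystar y}"

end

theory Submission
  imports Defs
begin

text \<open>The inequalities between the moduli in metric spaces only compare suprema: a rate witnessing
  surjection near a point witnesses openness at every graph point near it, and the limes inferior
  counts the reference point itself.

  In normed spaces, a map that contracts the graph towards a point of the graph shrinks an inclusion
  between two balls to an inclusion between proportionally smaller balls
  (\<open>cball_scaled_subset_image\<close>). One ball inclusion at a star centre therefore gives a linear rate
  at all small scales. When the graph is convex, every graph point is a star centre, and
  a single inclusion at \<open>(x, y)\<close> survives, with a slightly smaller rate, when the centres are moved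
  slightly; hence openness at a point already gives openness around it.

  For a convex process, scaling makes all radii equivalent, so the modulus of openness at the origin
  is the supremum of the \<open>r\<close> with \<open>r \<bullet> B \<subseteq> F(B)\<close>. Testing such an inclusion against an adjoint pair
  \<open>(y\<^sup>*, x\<^sup>*)\<close> bounds \<open>r\<close> by the norm of \<open>x\<^sup>*\<close>. Conversely, if \<open>r\<close> is below all these norms, then
  \<open>r \<bullet> B\<close> lies in the closure of \<open>F(B)\<close>: a point outside the closure gives a point \<open>(0, z)\<close> at
  positive distance from the graph in a suitable norm of the product space, and a functional
  separating it from the cone splits into an adjoint pair violating the lower bound
  (\<open>adjoint_witness_if_not_in_closure\<close>). Finally the closure is removed, at the cost of
  an arbitrarily small loss in \<open>r\<close>, by successive approximation as in Banach's open mapping theorem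
  (\<open>process_cover_if_dense_cover\<close>). The separation rests on the Hahn--Banach theorem for sublinear
  functionals, obtained from minimal sublinear functionals.\<close>

section \<open>Extended nonnegative numbers\<close>

lemma ennreal_le_if_reals_below_le:
  fixes a b :: ennreal
  assumes "\<And>c. c > 0 \<Longrightarrow> ennreal c < a \<Longrightarrow> ennreal c \<le> b"
  shows "a \<le> b"
proof (rule dense_le)
  fix x assume "x < a"
  then obtain c where c: "x = ennreal c" "c \<ge> 0"
    by (cases x) auto
  then show "x \<le> b"
    using assms[of c] \<open>x < a\<close> by (cases "c = 0") auto
qed

section \<open>Openness and surjection\<close>

text \<open>The map \<open>p \<mapsto> (1 - t) (x, y) + t p\<close> is a homothety centred at \<open>(x, y)\<close>; it multiplies the
  radii of both balls by \<open>t\<close>. For a convex graph only \<open>t \<le> 1\<close> is available, which shrinks balls; for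
  a cone with vertex at the centre, \<open>t > 1\<close> enlarges them.\<close>

lemma cball_scaled_subset_image:
  fixes F :: "'a::real_normed_vector \<Rightarrow> 'b::real_normed_vector set"
  assumes "t > 0" and into: "(\<lambda>p. (1 - t) *\<^sub>R (x, y) + t *\<^sub>R p) ` gph F \<subseteq> gph F"
    and cover: "cball y \<beta> \<subseteq> (\<Union>u\<in>cball x \<alpha>. F u)"
  shows "cball y (t * \<beta>) \<subseteq> (\<Union>u\<in>cball x (t * \<alpha>). F u)"
proof
  fix z assume z: "z \<in> cball y (t * \<beta>)"
  define w where "w = y + (1 / t) *\<^sub>R (z - y)"
  have "dist y z = t * dist y w"
    using \<open>t > 0\<close> by (simp add: w_def dist_norm norm_minus_commute)
  with z \<open>t > 0\<close> have "w \<in> cball y \<beta>" by simp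
  with cover obtain u where u: "u \<in> cball x \<alpha>" "w \<in> F u" by auto
  have "(1 - t) *\<^sub>R y + t *\<^sub>R w = z"
    using \<open>t > 0\<close> by (simp add: w_def algebra_simps)
  with into u(2) have "z \<in> F ((1 - t) *\<^sub>R x + t *\<^sub>R u)"
    by (force simp: gph_def)
  moreover have "dist x ((1 - t) *\<^sub>R x + t *\<^sub>R u) = t * dist x u"
  proof -
    have "x - ((1 - t) *\<^sub>R x + t *\<^sub>R u) = t *\<^sub>R (x - u)" by (simp add: algebra_simps)
    then show ?thesis using \<open>t > 0\<close> by (simp add: dist_norm)
  qed
  ultimately show "z \<in> (\<Union>u\<in>cball x (t * \<alpha>). F u)"
    using u(1) \<open>t > 0\<close> by (auto intro!: bexI[of _ "(1 - t) *\<^sub>R x + t *\<^sub>R u"])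
qed

lemma lopen_geI:
  assumes "c > 0" "\<epsilon> > 0"
    and "\<And>t. 0 < t \<Longrightarrow> t < \<epsilon> \<Longrightarrow> cball y (c * t) \<subseteq> (\<Union>u\<in>cball x t. F u)"
  shows "ennreal c \<le> lopen F x y"
  unfolding lopen_def
proof (intro Sup_upper CollectI exI conjI)
  show "\<forall>t\<in>{0<..<\<epsilon>}. cball y (c * t) \<subseteq> (\<Union>u\<in>cball x t. F u)"
    using assms(3) by simp
qed (use assms in auto)

lemma sur_geI:
  assumes "c > 0" "\<epsilon> > 0" "open U" "x \<in> U" "open V" "y \<in> V"
    and "\<And>x' y' t. x' \<in> U \<Longrightarrow> y' \<in> V \<Longrightarrow> y' \<in> F x' \<Longrightarrow> 0 < t \<Longrightarrow> t < \<epsilon> \<Longrightarrow>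
      cball y' (c * t) \<subseteq> (\<Union>u\<in>cball x' t. F u)"
  shows "ennreal c \<le> sur F x y"
  unfolding sur_def
proof (intro Sup_upper CollectI exI conjI)
  show "\<forall>x'\<in>U. \<forall>y'\<in>V. \<forall>t\<in>{0<..<\<epsilon>}. y' \<in> F x' \<longrightarrow>
           cball y' (c * t) \<subseteq> (\<Union>u\<in>cball x' t. F u)"
    using assms(7) by simp
qed (use assms in auto)

theorem liminf_gph_lopen_le_lopen:
  fixes F :: "'a::metric_space \<Rightarrow> 'b::metric_space set"
  assumes "(x, y) \<in> gph F"
  shows "liminf_gph F (lopen F) x y \<le> lopen F x y"
  unfolding liminf_gph_def
proof (rule SUP_least)
  fix r :: real assume "r \<in> {0<..}"
  with assms show "(INF (u, v)\<in>gph F \<inter> (ball x r \<times> ball y r). lopen F u v) \<le> lopen F x y"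
    by (intro INF_lower2[of "(x, y)"]) auto
qed

theorem sur_le_liminf_gph_lopen:
  fixes F :: "'a::metric_space \<Rightarrow> 'b::metric_space set"
  shows "sur F x y \<le> liminf_gph F (lopen F) x y"
  unfolding sur_def
proof (rule Sup_least, clarify)
  fix c \<epsilon> :: real and U V
  assume c: "c > 0" "\<epsilon> > 0" and UV: "open U" "x \<in> U" "open V" "y \<in> V"
    and cover: "\<forall>x'\<in>U. \<forall>y'\<in>V. \<forall>t\<in>{0<..<\<epsilon>}. y' \<in> F x' \<longrightarrow>
      cball y' (c * t) \<subseteq> (\<Union>u\<in>cball x' t. F u)"
  obtain r s where r: "r > 0" "ball x r \<subseteq> U" and s: "s > 0" "ball y s \<subseteq> V"
    using UV open_contains_ball by metis
  have "ennreal c \<le> lopen F u v"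
    if "(u, v) \<in> gph F \<inter> (ball x (min r s) \<times> ball y (min r s))" for u v
  proof (rule lopen_geI[OF c])
    have "u \<in> U" "v \<in> V" "v \<in> F u" using that r s by (auto simp: gph_def)
    then show "cball v (c * t) \<subseteq> (\<Union>w\<in>cball u t. F w)" if "0 < t" "t < \<epsilon>" for t
      using cover that by simp
  qed
  then have "ennreal c \<le> (INF (u, v)\<in>gph F \<inter> (ball x (min r s) \<times> ball y (min r s)). lopen F u v)"
    by (intro INF_greatest) auto
  also have "\<dots> \<le> liminf_gph F (lopen F) x y"
    unfolding liminf_gph_def using r s by (intro SUP_upper) auto
  finally show "ennreal c \<le> liminf_gph F (lopen F) x y" .
qed

theorem lopen_ge_if_starshaped:
  fixes F :: "'a::real_normed_vector \<Rightarrow> 'b::real_normed_vector set"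
  assumes star: "locally_starshaped_graph F x y" and pos: "\<alpha> > 0" "\<beta> > 0"
    and cover: "cball y \<beta> \<subseteq> (\<Union>u\<in>cball x \<alpha>. F u)"
  shows "ennreal (\<beta> / \<alpha>) \<le> lopen F x y"
proof -
  from star obtain a where a: "0 < a"
    and into: "\<And>t. t \<in> {0..a} \<Longrightarrow> (\<lambda>p. (1 - t) *\<^sub>R (x, y) + t *\<^sub>R p) ` gph F \<subseteq> gph F"
    unfolding locally_starshaped_graph_def by blast
  show ?thesis
  proof (rule lopen_geI)
    fix s assume "0 < s" "s < a * \<alpha>"
    then have "0 < s / \<alpha>" "s / \<alpha> \<in> {0..a}" using pos by (auto simp: field_simps)
    from cball_scaled_subset_image[OF this(1) into[OF this(2)] cover]
    show "cball y (\<beta> / \<alpha> * s) \<subseteq> (\<Union>u\<in>cball x s. F u)" using pos by (simp add: mult.commute)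
  qed (use a pos in auto)
qed

lemma convex_graph_starshaped:
  assumes "convex (gph F)" "(x, y) \<in> gph F" "0 \<le> t" "t \<le> 1"
  shows "(\<lambda>p. (1 - t) *\<^sub>R (x, y) + t *\<^sub>R p) ` gph F \<subseteq> gph F"
  using assms convexD[OF assms(1,2), of _ "1 - t" t] by auto

text \<open>Fix one inclusion of rate \<open>c\<close> with radius \<open>s\<close> at \<open>(x, y)\<close>. Moving both centres by at most \<open>\<delta>\<close> keeps
  the inclusion if the ball in the range is shrunk by \<open>\<delta>\<close> and the ball in the domain is enlarged
  by \<open>\<delta>\<close>, which leaves the rate \<open>(c s - \<delta>) / (s + \<delta>)\<close>. The moved point is again a star centre of the
  convex graph, so this rate passes to all smaller radii, uniformly in the moved point.\<close>

theorem lopen_eq_sur_if_convex: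
  fixes F :: "'a::real_normed_vector \<Rightarrow> 'b::real_normed_vector set"
  assumes gph: "(x, y) \<in> gph F" and "convex (gph F)"
  shows "lopen F x y = sur F x y"
proof (rule antisym)
  show "sur F x y \<le> lopen F x y"
    using sur_le_liminf_gph_lopen[of F x y] liminf_gph_lopen_le_lopen[OF gph] by (rule order_trans)
  show "lopen F x y \<le> sur F x y"
  proof (rule ennreal_le_if_reals_below_le)
    fix c' :: real assume c': "c' > 0" "ennreal c' < lopen F x y"
    then obtain c \<epsilon> where c: "ennreal c' < ennreal c" "c > 0" and "\<epsilon> > 0"
      and cover: "\<forall>t\<in>{0<..<\<epsilon>}. cball y (c * t) \<subseteq> (\<Union>u\<in>cball x t. F u)"
      unfolding lopen_def less_Sup_iff by auto
    have "c' < c" using c c'(1) by (simp add: ennreal_less_iff)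
    define s where "s = \<epsilon> / 2"
    have s: "0 < s" "s < \<epsilon>" using \<open>\<epsilon> > 0\<close> by (auto simp: s_def)
    \<comment> \<open>the solution of \<open>(c s - \<delta>) / (s + \<delta>) = c'\<close>\<close>
    define \<delta> where "\<delta> = (c - c') * s / (1 + c')"
    have "\<delta> > 0" using c' s \<open>c' < c\<close> by (simp add: \<delta>_def)
    have rate: "c * s - \<delta> = c' * (s + \<delta>)"
    proof -
      have "\<delta> * (1 + c') = (c - c') * s" using c'(1) by (simp add: \<delta>_def)
      then show ?thesis by (simp add: algebra_simps)
    qed
    show "ennreal c' \<le> sur F x y"
    proof (rule sur_geI)
      fix x' y' t
      assume near: "x' \<in> ball x \<delta>" "y' \<in> ball y \<delta>" and "y' \<in> F x'" and t: "0 < t" "t < s"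
      have "cball y' (c' * (s + \<delta>)) \<subseteq> cball y (c * s)"
        unfolding rate[symmetric] using near(2)
        by (simp add: subset_iff) (smt (verit) dist_triangle)
      also have "\<dots> \<subseteq> (\<Union>u\<in>cball x s. F u)" using cover s by simp
      also have "\<dots> \<subseteq> (\<Union>u\<in>cball x' (s + \<delta>). F u)"
      proof (rule UN_mono)
        show "cball x s \<subseteq> cball x' (s + \<delta>)"
          using near(1)
          by (simp add: subset_iff) (smt (verit) dist_triangle dist_commute)
      qed simp
      finally have "cball y' (t / (s + \<delta>) * (c' * (s + \<delta>)))
          \<subseteq> (\<Union>u\<in>cball x' (t / (s + \<delta>) * (s + \<delta>)). F u)"
      proof (rule cball_scaled_subset_image[rotated 2])
        show "(\<lambda>p. (1 - t / (s + \<delta>)) *\<^sub>R (x', y') + (t / (s + \<delta>)) *\<^sub>R p) ` gph F \<subseteq> gph F"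
          using \<open>y' \<in> F x'\<close> t \<open>\<delta> > 0\<close>
          by (intro convex_graph_starshaped \<open>convex (gph F)\<close>) (auto simp: gph_def)
      qed (use t \<open>\<delta> > 0\<close> in simp)
      moreover have "t / (s + \<delta>) * (c' * (s + \<delta>)) = c' * t" "t / (s + \<delta>) * (s + \<delta>) = t"
        using t \<open>\<delta> > 0\<close> by simp_all
      ultimately show "cball y' (c' * t) \<subseteq> (\<Union>u\<in>cball x' t. F u)" by simp
    qed (use \<open>c' > 0\<close> s \<open>\<delta> > 0\<close> in auto)
  qed
qed

section \<open>Sublinear functionals and the Hahn--Banach theorem\<close>

definition sublinear :: "('a::real_vector \<Rightarrow> real) \<Rightarrow> bool" where
  "sublinear p \<longleftrightarrow>
     (\<forall>x y. p (x + y) \<le> p x + p y) \<and> (\<forall>c x. c \<ge> 0 \<longrightarrow> p (c *\<^sub>R x) = c * p x)"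

lemma sublinear_add: "sublinear p \<Longrightarrow> p (x + y) \<le> p x + p y"
  and sublinear_scaleR: "sublinear p \<Longrightarrow> c \<ge> 0 \<Longrightarrow> p (c *\<^sub>R x) = c * p x"
  by (auto simp: sublinear_def)

lemma sublinear_0: "sublinear p \<Longrightarrow> p 0 = 0"
  using sublinear_scaleR[of p 0 0] by simp

lemma sublinear_minus: "sublinear p \<Longrightarrow> - p (- x) \<le> p x"
  using sublinear_add[of p x "- x"] sublinear_0[of p] by simp

lemma sublinearI:
  fixes p :: "'a::real_vector \<Rightarrow> real"
  assumes zero: "p 0 \<le> 0" and add: "\<And>x y. p (x + y) \<le> p x + p y"
    and scale: "\<And>c x. c > 0 \<Longrightarrow> p (c *\<^sub>R x) \<le> c * p x"
  shows "sublinear p"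
  unfolding sublinear_def
proof (intro conjI allI impI)
  fix c :: real and x assume "c \<ge> 0"
  show "p (c *\<^sub>R x) = c * p x"
  proof (cases "c = 0")
    case True
    then show ?thesis using zero add[of 0 0] by simp
  next
    case False
    with \<open>c \<ge> 0\<close> have "c > 0" by simp
    with scale[of "1 / c" "c *\<^sub>R x"] have "c * p x \<le> p (c *\<^sub>R x)" by (simp add: field_simps)
    with scale[OF \<open>c > 0\<close>, of x] show ?thesis by simp
  qed
qed (rule add)

lemma le_add_INF:
  fixes f :: "'i \<Rightarrow> real" and g :: "'j \<Rightarrow> real"
  assumes "I \<noteq> {}" "J \<noteq> {}" "\<And>i j. i \<in> I \<Longrightarrow> j \<in> J \<Longrightarrow> w \<le> f i + g j"
  shows "w \<le> (INF i\<in>I. f i) + (INF j\<in>J. g j)"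
proof -
  have "w - (INF i\<in>I. f i) \<le> g j" if "j \<in> J" for j
  proof -
    have "w - g j \<le> (INF i\<in>I. f i)"
      using assms that by (intro cINF_greatest) (auto simp: algebra_simps)
    then show ?thesis by simp
  qed
  then have "w - (INF i\<in>I. f i) \<le> (INF j\<in>J. g j)"
    using assms by (intro cINF_greatest) auto
  then show ?thesis by simp
qed

text \<open>The hypotheses say that the family, although not closed under sums, contains for each pair of
  members one that does at least as well at the sum of the arguments. The infimal constructions
  below (along a ray, over a chain, and over a convex cone) all have this shape.\<close>

lemma sublinear_INF:
  fixes f :: "'i \<Rightarrow> 'a::real_vector \<Rightarrow> real"
  assumes ne: "I \<noteq> {}" and below: "\<And>i x. i \<in> I \<Longrightarrow> l x \<le> f i x"
    and zero: "\<exists>k\<in>I. f k 0 \<le> 0"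
    and add: "\<And>i j x y. i \<in> I \<Longrightarrow> j \<in> I \<Longrightarrow> \<exists>k\<in>I. f k (x + y) \<le> f i x + f j y"
    and scale: "\<And>c i x. c > 0 \<Longrightarrow> i \<in> I \<Longrightarrow> \<exists>k\<in>I. f k (c *\<^sub>R x) \<le> c * f i x"
  shows "sublinear (\<lambda>x. INF i\<in>I. f i x)"
proof -
  have le: "(INF i\<in>I. f i x) \<le> w" if "\<exists>k\<in>I. f k x \<le> w" for x w
  proof -
    from that obtain k where "k \<in> I" "f k x \<le> w" by auto
    moreover have "bdd_below ((\<lambda>i. f i x) ` I)" using below by (intro bdd_belowI2)
    ultimately show ?thesis by (intro cINF_lower2)
  qed
  show ?thesis
  proof (rule sublinearI)
    show "(INF i\<in>I. f i 0) \<le> 0" by (rule le[OF zero])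
  next
    fix x y
    show "(INF i\<in>I. f i (x + y)) \<le> (INF i\<in>I. f i x) + (INF i\<in>I. f i y)"
      by (intro le_add_INF ne le add)
  next
    fix c :: real and x assume "c > 0"
    have "(INF i\<in>I. f i (c *\<^sub>R x)) / c \<le> (INF i\<in>I. f i x)"
    proof (rule cINF_greatest[OF ne])
      fix i assume "i \<in> I"
      then show "(INF i\<in>I. f i (c *\<^sub>R x)) / c \<le> f i x"
        using le[OF scale[OF \<open>c > 0\<close>, of i x]] \<open>c > 0\<close> by (simp add: field_simps)
    qed
    then show "(INF i\<in>I. f i (c *\<^sub>R x)) \<le> c * (INF i\<in>I. f i x)"
      using \<open>c > 0\<close> by (simp add: field_simps)
  qed
qed

text \<open>A sublinear functional satisfies \<open>- p z \<le> p (- z)\<close>, with equality for all \<open>z\<close> exactly when it is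
  linear. Equality at one \<open>z\<close> is enforced by \<open>inf {p (x + t z) - t p z | t \<ge> 0}\<close>. This serves
  to show that minimal sublinear functionals are linear, and also to prescribe the
  value at \<open>z\<close> of a linear minorant.\<close>

lemma sublinear_minorant_tight_at:
  fixes p :: "'a::real_vector \<Rightarrow> real"
  assumes p: "sublinear p"
  obtains p' where "sublinear p'" "p' \<le> p" "p' (- z) = - p z"
proof
  define f where "f t x = p (x + t *\<^sub>R z) - t * p z" for t x
  define p' where "p' x = (INF t\<in>{0..}. f t x)" for x
  have below: "- p (- x) \<le> f t x" if "t \<in> {0..}" for t x
  proof -
    have "t * p z = p (t *\<^sub>R z)" using that by (simp add: sublinear_scaleR[OF p])
    also have "\<dots> \<le> p (x + t *\<^sub>R z) + p (- x)"
      using sublinear_add[OF p, of "x + t *\<^sub>R z" "- x"] by simp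
    finally show ?thesis by (simp add: f_def)
  qed
  have le: "p' x \<le> f t x" if "t \<ge> 0" for t x
    unfolding p'_def using that below by (intro cINF_lower bdd_belowI2[of _ "- p (- x)"]) auto
  show "sublinear p'"
    unfolding p'_def
  proof (rule sublinear_INF[OF _ below])
    show "\<exists>k\<in>{0..}. f k 0 \<le> 0"
      by (rule bexI[of _ 0]) (auto simp: f_def sublinear_0[OF p])
  next
    fix s t :: real and x y assume "s \<in> {0..}" "t \<in> {0..}"
    then show "\<exists>k\<in>{0..}. f k (x + y) \<le> f s x + f t y"
      using sublinear_add[OF p, of "x + s *\<^sub>R z" "y + t *\<^sub>R z"]
      by (intro bexI[of _ "s + t"]) (auto simp: f_def algebra_simps)
  next
    fix c t :: real and x assume "c > 0" "t \<in> {0..}"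
    then show "\<exists>k\<in>{0..}. f k (c *\<^sub>R x) \<le> c * f t x"
      using sublinear_scaleR[OF p, of c "x + t *\<^sub>R z"]
      by (intro bexI[of _ "c * t"]) (auto simp: f_def algebra_simps)
  qed simp
  show "p' \<le> p" using le[of 0] by (simp add: le_fun_def f_def)
  show "p' (- z) = - p z"
  proof (rule antisym)
    show "p' (- z) \<le> - p z" using le[of 1 "- z"] by (simp add: f_def sublinear_0[OF p])
    show "- p z \<le> p' (- z)"
      unfolding p'_def using below[of _ "- z"] by (intro cINF_greatest) auto
  qed
qed

text \<open>Zorn's lemma gives a minimal sublinear functional below \<open>q\<close>. By minimality it agrees with each of
  its own minorants of the preceding lemma, hence it is odd, and an odd sublinear functional
  is linear. Chains are bounded below because every member dominates \<open>- q (- x)\<close>.\<close>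

theorem Hahn_Banach:
  fixes q :: "'a::real_vector \<Rightarrow> real"
  assumes q: "sublinear q"
  obtains f where "linear f" "\<And>x. f x \<le> q x"
proof -
  define A where "A = {p. sublinear p \<and> p \<le> q}"
  have "\<exists>m\<in>A. \<forall>p\<in>A. m \<ge> p \<longrightarrow> p = m"
  proof (rule predicate_Zorn)
    show "partial_order_on A (relation_of (\<ge>) A)"
      by (rule partial_order_on_relation_ofI) auto
  next
    fix C assume C: "C \<in> Chains (relation_of (\<ge>) A)"
    then have sub: "C \<subseteq> A" by (rule Chains_relation_of)
    have chain: "p \<le> p' \<or> p' \<le> p" if "p \<in> C" "p' \<in> C" for p p'
      using C that by (auto simp: Chains_def relation_of_def)
    show "\<exists>u\<in>A. \<forall>p\<in>C. p \<ge> u"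
    proof (cases "C = {}")
      case True
      then show ?thesis using q by (auto simp: A_def)
    next
      case False
      define u where "u x = (INF p\<in>C. p x)" for x
      have lin: "sublinear p" if "p \<in> C" for p using sub that by (auto simp: A_def)
      have below: "- q (- x) \<le> p x" if "p \<in> C" for p x
      proof -
        have "p (- x) \<le> q (- x)" using sub that by (auto simp: A_def le_fun_def)
        then show ?thesis using sublinear_minus[OF lin[OF that], of x] by simp
      qed
      have le: "u \<le> p" if "p \<in> C" for p
        unfolding u_def le_fun_def
        using that below by (auto intro!: cINF_lower bdd_belowI2)
      have "sublinear u"
        unfolding u_def
      proof (rule sublinear_INF[OF False below])
        show "\<exists>p\<in>C. p 0 \<le> 0" using False sublinear_0[OF lin] by fastforce
      next
        fix p p' x y assume pp': "p \<in> C" "p' \<in> C"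
        from chain[OF this] show "\<exists>r\<in>C. r (x + y) \<le> p x + p' y"
        proof
          assume "p \<le> p'"
          then have "p y \<le> p' y" by (simp add: le_fun_def)
          then show ?thesis using sublinear_add[OF lin[OF pp'(1)], of x y] pp'
            by (intro bexI[of _ p]) auto
        next
          assume "p' \<le> p"
          then have "p' x \<le> p x" by (simp add: le_fun_def)
          then show ?thesis using sublinear_add[OF lin[OF pp'(2)], of x y] pp'
            by (intro bexI[of _ p']) auto
        qed
      next
        fix c :: real and p x assume "c > 0" "p \<in> C"
        then show "\<exists>r\<in>C. r (c *\<^sub>R x) \<le> c * p x"
          using sublinear_scaleR[OF lin] by (intro bexI[of _ p]) auto
      qed
      moreover have "u \<le> q"
        using False le sub by (auto simp: A_def intro: order_trans)
      ultimately show ?thesis using le by (auto simp: A_def)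
    qed
  qed
  then obtain m where m: "sublinear m" "m \<le> q"
    and minimal: "\<And>p. sublinear p \<Longrightarrow> p \<le> m \<Longrightarrow> p = m"
    unfolding A_def by (auto intro: order_trans)
  have odd: "m (- z) = - m z" for z
    using sublinear_minorant_tight_at[OF m(1), of z] minimal by metis
  have "linear m"
  proof (rule linearI)
    fix x y
    show "m (x + y) = m x + m y"
      using sublinear_add[OF m(1), of x y] sublinear_add[OF m(1), of "x + y" "- y"] odd[of y]
      by simp
  next
    fix c :: real and x
    show "m (c *\<^sub>R x) = c *\<^sub>R m x"
      using sublinear_scaleR[OF m(1), of c x] sublinear_scaleR[OF m(1), of "- c" x] odd[of "c *\<^sub>R x"]
      by (cases "c \<ge> 0") auto
  qed
  with m(2) show ?thesis by (intro that[of m]) (auto simp: le_fun_def)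
qed

text \<open>The \<open>N\<close>-distance to a convex cone is sublinear, is at most \<open>N\<close>, and vanishes on the cone. A linear
  minorant of it that attains its value at \<open>z\<close> is the required functional.\<close>

lemma convex_cone_separation:
  fixes N :: "'a::real_vector \<Rightarrow> real"
  assumes N: "sublinear N" and nonneg: "\<And>z. 0 \<le> N z" and K: "convex_cone K"
    and far: "\<And>k. k \<in> K \<Longrightarrow> 1 \<le> N (z - k)"
  obtains f where "linear f" "\<And>w. f w \<le> N w" "\<And>k. k \<in> K \<Longrightarrow> f k \<le> 0" "1 \<le> f z"
proof -
  define Q where "Q w = (INF k\<in>K. N (w - k))" for w
  have ne: "K \<noteq> {}" and "0 \<in> K"
    using K by (auto simp: convex_cone_nonempty convex_cone_contains_0)
  have le: "Q w \<le> N (w - k)" if "k \<in> K" for w k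
    unfolding Q_def using that nonneg by (intro cINF_lower bdd_belowI2[of _ 0]) auto
  have "sublinear Q"
    unfolding Q_def
  proof (rule sublinear_INF[OF ne nonneg])
    show "\<exists>k\<in>K. N (0 - k) \<le> 0"
      using \<open>0 \<in> K\<close> by (intro bexI[of _ 0]) (simp_all add: sublinear_0[OF N])
  next
    fix k l x y assume "k \<in> K" "l \<in> K"
    then show "\<exists>m\<in>K. N (x + y - m) \<le> N (x - k) + N (y - l)"
      using sublinear_add[OF N, of "x - k" "y - l"] convex_cone_add[OF K]
      by (intro bexI[of _ "k + l"]) (auto simp: algebra_simps)
  next
    fix c :: real and k x assume "c > 0" "k \<in> K"
    then show "\<exists>m\<in>K. N (c *\<^sub>R x - m) \<le> c * N (x - k)"
      using sublinear_scaleR[OF N, of c "x - k"] convex_cone_scaleR[OF K]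
      by (intro bexI[of _ "c *\<^sub>R k"]) (auto simp: algebra_simps)
  qed
  then obtain Q' where Q': "sublinear Q'" "Q' \<le> Q" "Q' (- z) = - Q z"
    by (rule sublinear_minorant_tight_at)
  obtain f where f: "linear f" "\<And>w. f w \<le> Q' w" using Hahn_Banach[OF Q'(1)] by metis
  have fQ: "f w \<le> Q w" for w using f(2) Q'(2) by (meson le_funD order_trans)
  have "1 \<le> Q z" unfolding Q_def using ne far by (intro cINF_greatest)
  show ?thesis
  proof (rule that[OF f(1)])
    show "f w \<le> N w" for w using fQ[of w] le[OF \<open>0 \<in> K\<close>, of w] by simp
    show "f k \<le> 0" if "k \<in> K" for k using fQ[of k] le[OF that, of k] by (simp add: sublinear_0[OF N])
    show "1 \<le> f z" using f(2)[of "- z"] Q'(3) \<open>1 \<le> Q z\<close> by (simp add: linear_neg[OF f(1)])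
  qed
qed

section \<open>Convex processes\<close>

text \<open>A convex process is positively homogeneous, so an inclusion at one radius holds at every radius.\<close>

lemma process_cball_cover_iff:
  fixes F :: "'a::real_normed_vector \<Rightarrow> 'b::real_normed_vector set"
  assumes K: "convex_cone (gph F)" and "t > 0"
  shows "cball 0 (c * t) \<subseteq> (\<Union>u\<in>cball 0 t. F u) \<longleftrightarrow> cball 0 c \<subseteq> (\<Union>u\<in>cball 0 1. F u)"
proof -
  have into: "(\<lambda>p. (1 - s) *\<^sub>R (0, 0) + s *\<^sub>R p) ` gph F \<subseteq> gph F" if "s > 0" for s
    using convex_cone_scaleR[OF K, of s] that by (auto simp: zero_prod_def[symmetric])
  show ?thesis
    using cball_scaled_subset_image[OF \<open>t > 0\<close> into[OF \<open>t > 0\<close>], of c 1]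
      cball_scaled_subset_image[of "1 / t", OF _ into, of "c * t" t] \<open>t > 0\<close>
    by (auto simp: mult.commute)
qed

theorem lopen_process:
  fixes F :: "'a::real_normed_vector \<Rightarrow> 'b::real_normed_vector set"
  assumes K: "convex_cone (gph F)"
  shows "lopen F 0 0 = Sup {ennreal r | r. r > 0 \<and> cball 0 r \<subseteq> (\<Union>u\<in>cball 0 1. F u)}"
proof -
  have "(\<exists>\<epsilon>>0. \<forall>t\<in>{0<..<\<epsilon>}. cball 0 (c * t) \<subseteq> (\<Union>u\<in>cball 0 t. F u)) \<longleftrightarrow>
      cball 0 c \<subseteq> (\<Union>u\<in>cball 0 1. F u)" (is "?l \<longleftrightarrow> ?r") for c :: real
  proof
    assume ?l
    then obtain \<epsilon> :: real where \<epsilon>: "\<epsilon> > 0"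
      and "\<forall>t\<in>{0<..<\<epsilon>}. cball 0 (c * t) \<subseteq> (\<Union>u\<in>cball 0 t. F u)" by blast
    then have "cball 0 (c * (\<epsilon> / 2)) \<subseteq> (\<Union>u\<in>cball 0 (\<epsilon> / 2). F u)"
      by (elim ballE[of _ _ "\<epsilon> / 2"]) simp_all
    then show ?r using process_cball_cover_iff[OF K, of "\<epsilon> / 2" c] \<epsilon> by simp
  next
    assume ?r
    then show ?l using process_cball_cover_iff[OF K, of _ c] by (intro exI[of _ 1]) auto
  qed
  then show ?thesis unfolding lopen_def by simp
qed

text \<open>If \<open>- r y \<in> F u\<close> with \<open>u\<close> in the unit ball, then
  \<open>r \<langle>y\<^sup>*, y\<rangle> \<le> - \<langle>x\<^sup>*, u\<rangle> \<le> \<parallel>x\<^sup>*\<parallel>\<close>; the supremum of the left side over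
  the unit ball is \<open>r \<parallel>y\<^sup>*\<parallel> = r\<close>.\<close>

lemma process_cover_le_norm_adjoint:
  fixes F :: "'a::real_normed_vector \<Rightarrow> 'b::real_normed_vector set"
  assumes "r > 0" and cover: "cball 0 r \<subseteq> (\<Union>u\<in>cball 0 1. F u)"
    and ystar: "norm ystar = 1" and xstar: "xstar \<in> adjoint_process F ystar"
  shows "r \<le> norm xstar"
proof -
  have pairing: "r * blinfun_apply ystar y \<le> norm xstar" if "norm y \<le> 1" for y
  proof -
    have "- (r *\<^sub>R y) \<in> cball 0 r" using that \<open>r > 0\<close> by simp
    from subsetD[OF cover this] obtain u where u: "norm u \<le> 1" "- (r *\<^sub>R y) \<in> F u" by auto
    have "blinfun_apply xstar u \<le> blinfun_apply ystar (- (r *\<^sub>R y))"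
      using xstar u(2) by (auto simp: adjoint_process_def gph_def)
    moreover have "- norm xstar \<le> blinfun_apply xstar u"
    proof -
      have "norm (blinfun_apply xstar u) \<le> norm xstar * norm u" by (rule norm_blinfun)
      also have "\<dots> \<le> norm xstar" using u(1) by (simp add: mult_left_le)
      finally show ?thesis by simp
    qed
    ultimately show ?thesis by (simp add: blinfun.minus_right blinfun.scaleR_right)
  qed
  have "norm ystar \<le> norm xstar / r"
  proof (rule norm_blinfun_bound)
    fix y
    show "norm (blinfun_apply ystar y) \<le> norm xstar / r * norm y"
    proof (cases "y = 0")
      case False
      then show ?thesis
        using pairing[of "(1 / norm y) *\<^sub>R y"] pairing[of "- ((1 / norm y) *\<^sub>R y)"] \<open>r > 0\<close>
        by (simp add: blinfun.minus_right blinfun.scaleR_right field_simps abs_le_iff)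
    qed (simp add: blinfun.zero_right)
  qed (use \<open>r > 0\<close> in simp)
  then show ?thesis using ystar \<open>r > 0\<close> by (simp add: field_simps)
qed

text \<open>Let \<open>\<delta> > 0\<close> bound from below the distance from \<open>z\<close> to the image of the unit ball, and put
  \<open>N (x, y) = max \<parallel>x\<parallel> (\<parallel>y\<parallel> / \<delta>)\<close>. A graph point \<open>(u, w)\<close> has \<open>\<parallel>u\<parallel> > 1\<close> or \<open>\<parallel>z - w\<parallel> \<ge> \<delta>\<close>, so
  it has \<open>N\<close>-distance at least 1 from \<open>(0, z)\<close>. A separating functional has the form
  \<open>(x, y) \<mapsto> a x + b y\<close>. It is dominated by \<open>N\<close>, whence \<open>\<parallel>a\<parallel> \<le> 1\<close>, and \<open>b z \<ge> 1\<close> forces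
  \<open>\<parallel>b\<parallel> \<ge> 1 / r\<close>. Being nonpositive on the graph, it yields the adjoint pair
  \<open>y\<^sup>* = - b / \<parallel>b\<parallel>\<close> and \<open>x\<^sup>* = a / \<parallel>b\<parallel>\<close>. Carrying out the separation in the product space
  makes one application of Hahn--Banach produce both functionals.\<close>

lemma adjoint_witness_if_not_in_closure:
  fixes F :: "'a::real_normed_vector \<Rightarrow> 'b::real_normed_vector set"
  assumes K: "convex_cone (gph F)" and z: "norm z \<le> r" "z \<notin> closure (\<Union>u\<in>cball 0 1. F u)"
  obtains ystar xstar where "norm ystar = 1" "xstar \<in> adjoint_process F ystar" "norm xstar \<le> r"
proof -
  from z(2) obtain \<delta> where "\<delta> > 0"
    and far: "\<And>u w. norm u \<le> 1 \<Longrightarrow> w \<in> F u \<Longrightarrow> \<delta> \<le> norm (z - w)"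
    unfolding closure_approachable by (force simp: dist_norm norm_minus_commute not_less)
  define N :: "'a \<times> 'b \<Rightarrow> real" where "N p = max (norm (fst p)) (norm (snd p) / \<delta>)" for p
  have N_sub: "sublinear N"
    unfolding sublinear_def
  proof (intro conjI allI impI)
    fix p q :: "'a \<times> 'b"
    have "norm (snd p + snd q) / \<delta> \<le> norm (snd p) / \<delta> + norm (snd q) / \<delta>"
      using norm_triangle_ineq[of "snd p" "snd q"] \<open>\<delta> > 0\<close>
      by (simp add: add_divide_distrib[symmetric] divide_right_mono)
    then show "N (p + q) \<le> N p + N q"
      using norm_triangle_ineq[of "fst p" "fst q"] by (auto simp: N_def)
  next
    fix c :: real and p :: "'a \<times> 'b" assume "c \<ge> 0"
    then show "N (c *\<^sub>R p) = c * N p"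
      using max_mult_distrib_left[of c "norm (fst p)" "norm (snd p) / \<delta>"] by (auto simp: N_def)
  qed
  have N_nonneg: "0 \<le> N p" for p by (simp add: N_def le_max_iff_disj)
  have N_far: "1 \<le> N ((0, z) - k)" if "k \<in> gph F" for k
  proof (cases "norm (fst k) \<le> 1")
    case True
    then have "\<delta> \<le> norm (z - snd k)" using far[of "fst k" "snd k"] that by (auto simp: gph_def)
    then show ?thesis using \<open>\<delta> > 0\<close> by (simp add: N_def le_max_iff_disj)
  qed (simp add: N_def le_max_iff_disj)
  obtain f where f: "linear f" "\<And>p. f p \<le> N p" "\<And>k. k \<in> gph F \<Longrightarrow> f k \<le> 0" "1 \<le> f (0, z)"
    using convex_cone_separation[OF N_sub N_nonneg K N_far] by metis
  have abs_f: "\<bar>f p\<bar> \<le> N p" for p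
    using f(2)[of p] f(2)[of "- p"] by (simp add: linear_neg[OF f(1)] N_def)
  have split: "f (x, y) = f (x, 0) + f (0, y)" for x y
    using linear_add[OF f(1), of "(x, 0)" "(0, y)"] by simp
  have bl_a: "bounded_linear (\<lambda>x. f (x, 0))"
  proof (rule bounded_linear_intro[where K = 1])
    show "norm (f (x, 0)) \<le> norm x * 1" for x using abs_f[of "(x, 0)"] by (simp add: N_def)
  qed (use linear_add[OF f(1), of "(_, 0)" "(_, 0)"] linear_scale[OF f(1), of _ "(_, 0)"] in auto)
  have bl_b: "bounded_linear (\<lambda>y. f (0, y))"
  proof (rule bounded_linear_intro[where K = "1 / \<delta>"])
    show "norm (f (0, y)) \<le> norm y * (1 / \<delta>)" for y
      using abs_f[of "(0, y)"] \<open>\<delta> > 0\<close> by (simp add: N_def)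
  qed (use linear_add[OF f(1), of "(0, _)" "(0, _)"] linear_scale[OF f(1), of _ "(0, _)"] in auto)
  define a b where "a = Blinfun (\<lambda>x. f (x, 0))" and "b = Blinfun (\<lambda>y. f (0, y))"
  have a: "blinfun_apply a x = f (x, 0)" for x
    using bounded_linear_Blinfun_apply[OF bl_a] by (simp add: a_def)
  have b: "blinfun_apply b y = f (0, y)" for y
    using bounded_linear_Blinfun_apply[OF bl_b] by (simp add: b_def)
  have "norm a \<le> 1"
    by (rule norm_blinfun_bound) (use abs_f[of "(_, 0)"] in \<open>simp_all add: a N_def\<close>)
  have "1 \<le> norm b * r"
  proof -
    have "1 \<le> norm (blinfun_apply b z)" using f(4) by (simp add: b)
    also have "\<dots> \<le> norm b * norm z" by (rule norm_blinfun)
    also have "\<dots> \<le> norm b * r" using z(1) by (simp add: mult_left_mono)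
    finally show ?thesis .
  qed
  then have "norm b > 0" by (cases "b = 0") auto
  show ?thesis
  proof (rule that)
    show "norm ((- 1 / norm b) *\<^sub>R b) = 1" using \<open>norm b > 0\<close> by simp
    show "(1 / norm b) *\<^sub>R a \<in> adjoint_process F ((- 1 / norm b) *\<^sub>R b)"
      unfolding adjoint_process_def
    proof (rule CollectI, clarify)
      fix x y assume "(x, y) \<in> gph F"
      then have "f (x, 0) + f (0, y) \<le> 0" using f(3) split by metis
      then have "(f (x, 0) + f (0, y)) / norm b \<le> 0" using \<open>norm b > 0\<close>
        by (simp add: divide_nonpos_pos)
      then show "blinfun_apply ((1 / norm b) *\<^sub>R a) x \<le> blinfun_apply ((- 1 / norm b) *\<^sub>R b) y"
        by (simp add: a b add_divide_distrib blinfun.scaleR_left blinfun.minus_left)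
    qed
    show "norm ((1 / norm b) *\<^sub>R a) \<le> r"
      using \<open>norm a \<le> 1\<close> \<open>1 \<le> norm b * r\<close> \<open>norm b > 0\<close> by (simp add: field_simps)
  qed
qed

text \<open>Approximate \<open>y\<close> by a value of \<open>F\<close>, approximate the remainder in the same way, and so on. With
  remainders shrinking by the factor \<open>\<theta>\<close>, the arguments used have norms at most \<open>(s / r) \<theta>\<^sup>n\<close>.
  They are summable by completeness of the domain, and the sum of the graph points used lies in the
  closed convex cone.\<close>

theorem process_cover_if_dense_cover:
  fixes F :: "'a::banach \<Rightarrow> 'b::real_normed_vector set"
  assumes "closed (gph F)" and K: "convex_cone (gph F)" and r: "0 < s" "s < r"
    and dense: "cball 0 r \<subseteq> closure (\<Union>u\<in>cball 0 1. F u)"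
  shows "cball 0 s \<subseteq> (\<Union>u\<in>cball 0 1. F u)"
proof
  fix y :: 'b assume "y \<in> cball 0 s"
  then have y: "norm y \<le> s" by simp
  \<comment> \<open>chosen so that the geometric series \<open>s / r + (s / r) \<theta> + \<dots>\<close> sums to exactly 1\<close>
  define \<theta> where "\<theta> = 1 - s / r"
  have \<theta>: "0 < \<theta>" "\<theta> < 1" using r by (auto simp: \<theta>_def)
  have approx: "\<exists>p\<in>gph F. norm (fst p) \<le> \<rho> / r \<and> norm (z - snd p) \<le> \<theta> * \<rho>"
    if "\<rho> > 0" "norm z \<le> \<rho>" for z \<rho>
  proof -
    have "norm z * r \<le> \<rho> * r" using that r by (intro mult_right_mono) auto
    then have "(r / \<rho>) *\<^sub>R z \<in> cball 0 r" using that r by (simp add: field_simps)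
    then have "(r / \<rho>) *\<^sub>R z \<in> closure (\<Union>u\<in>cball 0 1. F u)" using dense by blast
    moreover have "\<theta> * r > 0" using \<theta> r by simp
    ultimately obtain u w where u: "norm u \<le> 1" "w \<in> F u" and w: "dist w ((r / \<rho>) *\<^sub>R z) < \<theta> * r"
      unfolding closure_approachable by auto
    have "(\<rho> / r) *\<^sub>R (u, w) \<in> gph F"
      using u(2) that r by (intro convex_cone_scaleR[OF K]) (auto simp: gph_def)
    moreover have "norm ((\<rho> / r) *\<^sub>R u) \<le> \<rho> / r"
      using u(1) that r by (simp add: mult_left_le field_simps)
    moreover have "norm (z - (\<rho> / r) *\<^sub>R w) \<le> \<theta> * \<rho>"
    proof -
      have "z - (\<rho> / r) *\<^sub>R w = (\<rho> / r) *\<^sub>R ((r / \<rho>) *\<^sub>R z - w)"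
        using that r by (simp add: algebra_simps)
      then have "norm (z - (\<rho> / r) *\<^sub>R w) = (\<rho> / r) * norm ((r / \<rho>) *\<^sub>R z - w)"
        using that r by simp
      also have "\<dots> \<le> (\<rho> / r) * (\<theta> * r)"
        using w that r by (intro mult_left_mono) (auto simp: dist_norm norm_minus_commute)
      also have "\<dots> = \<theta> * \<rho>" using r by simp
      finally show ?thesis .
    qed
    ultimately show ?thesis by (intro bexI[of _ "(\<rho> / r) *\<^sub>R (u, w)"]) auto
  qed
  have "\<forall>n z. \<exists>p. norm z \<le> s * \<theta> ^ n \<longrightarrow>
      p \<in> gph F \<and> norm (fst p) \<le> s * \<theta> ^ n / r \<and> norm (z - snd p) \<le> \<theta> * (s * \<theta> ^ n)"
    using approx r \<theta> by (metis mult_pos_pos zero_less_power)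
  then obtain g where g: "\<And>n z. norm z \<le> s * \<theta> ^ n \<Longrightarrow>
      g n z \<in> gph F \<and> norm (fst (g n z)) \<le> s * \<theta> ^ n / r \<and> norm (z - snd (g n z)) \<le> \<theta> * (s * \<theta> ^ n)"
    by metis
  \<comment> \<open>\<open>R n\<close> is what remains of \<open>y\<close> after \<open>n\<close> approximations\<close>
  define R where "R = rec_nat y (\<lambda>n z. z - snd (g n z))"
  have R_simps: "R 0 = y" "\<And>n. R (Suc n) = R n - snd (g n (R n))" by (simp_all add: R_def)
  have R_bound: "norm (R n) \<le> s * \<theta> ^ n" for n
  proof (induction n)
    case (Suc n)
    then show ?case using g[of "R n" n] by (simp add: R_simps mult_ac)
  qed (simp add: R_simps y)
  define p where "p n = g n (R n)" for n
  have p: "p n \<in> gph F" "norm (fst (p n)) \<le> s / r * \<theta> ^ n" for n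
    using g[OF R_bound, of n] by (auto simp: p_def)
  have geo: "(\<lambda>n. s / r * \<theta> ^ n) sums 1"
    using sums_mult[OF geometric_sums[of \<theta>], of "s / r"] \<theta> r by (simp add: \<theta>_def)
  have summ: "summable (\<lambda>n. norm (fst (p n)))"
    by (rule summable_comparison_test'[OF sums_summable[OF geo], of 0]) (use p(2) in simp)
  define x where "x = (\<Sum>n. fst (p n))"
  have "norm x \<le> (\<Sum>n. norm (fst (p n)))" unfolding x_def by (rule summable_norm[OF summ])
  also have "\<dots> \<le> (\<Sum>n. s / r * \<theta> ^ n)"
    by (intro suminf_le p(2) summ sums_summable[OF geo])
  also have "\<dots> = 1" using geo by (simp add: sums_iff)
  finally have "norm x \<le> 1" .
  have partial: "(\<Sum>i<n. p i) \<in> gph F" for n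
    by (induction n) (auto intro: convex_cone_add[OF K] p(1) convex_cone_contains_0[OF K])
  have snd_sum: "snd (\<Sum>i<n. p i) = y - R n" for n
    by (induction n) (auto simp: R_simps p_def)
  have fst_sum: "fst (\<Sum>i<n. p i) = (\<Sum>i<n. fst (p i))" for n
    by (induction n) auto
  have "R \<longlonglongrightarrow> 0"
  proof (rule Lim_null_comparison[OF always_eventually])
    show "\<forall>n. norm (R n) \<le> s * \<theta> ^ n" using R_bound by blast
    show "(\<lambda>n. s * \<theta> ^ n) \<longlonglongrightarrow> 0"
      using \<theta> by (intro tendsto_mult_right_zero LIMSEQ_power_zero) simp
  qed
  then have "(\<lambda>n. snd (\<Sum>i<n. p i)) \<longlonglongrightarrow> y"
    unfolding snd_sum using tendsto_diff[OF tendsto_const, of R 0 sequentially y] by simp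
  moreover have "(\<lambda>n. fst (\<Sum>i<n. p i)) \<longlonglongrightarrow> x"
    unfolding fst_sum x_def by (rule summable_LIMSEQ[OF summable_norm_cancel[OF summ]])
  ultimately have "(\<lambda>n. \<Sum>i<n. p i) \<longlonglongrightarrow> (x, y)"
    using tendsto_Pair by fastforce
  then have "(x, y) \<in> gph F"
    by (rule closed_sequentially[OF \<open>closed (gph F)\<close> partial])
  then show "y \<in> (\<Union>u\<in>cball 0 1. F u)" using \<open>norm x \<le> 1\<close> by (auto simp: gph_def)
qed

theorem Sup_cover_eq_Inf_norm_adjoint:
  fixes F :: "'a::banach \<Rightarrow> 'b::real_normed_vector set"
  assumes "closed_convex_process F"
  shows "Sup {ennreal r | r. r > 0 \<and> cball 0 r \<subseteq> (\<Union>x\<in>cball 0 1. F x)} =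
    Inf {ennreal (norm xstar) | xstar. xstar \<in> (\<Union>ystar\<in>sphere 0 1. adjoint_process F ystar)}"
    (is "?sup = ?inf")
proof (rule antisym)
  have K: "closed (gph F)" "convex_cone (gph F)"
    using assms by (auto simp: closed_convex_process_def)
  show "?sup \<le> ?inf"
    by (rule Sup_least, rule Inf_greatest)
      (auto intro!: ennreal_leI process_cover_le_norm_adjoint)
  show "?inf \<le> ?sup"
  proof (rule ennreal_le_if_reals_below_le)
    fix s :: real assume s: "s > 0" "ennreal s < ?inf"
    \<comment> \<open>an intermediate radius \<open>r\<close> leaves room for the loss incurred when the closure is removed\<close>
    then obtain e where e: "ennreal s < e" "e < ?inf" using dense by blast
    then obtain r where r: "e = ennreal r" "r \<ge> 0" by (cases e) auto
    have "s < r" using e r s by (simp add: ennreal_less_iff)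
    have "cball 0 r \<subseteq> closure (\<Union>u\<in>cball 0 1. F u)"
    proof (rule ccontr)
      assume "\<not> ?thesis"
      then obtain z where "z \<in> cball 0 r" "z \<notin> closure (\<Union>u\<in>cball 0 1. F u)" by blast
      moreover from this(1) have "norm z \<le> r" by simp
      ultimately obtain ystar xstar
        where w: "norm ystar = 1" "xstar \<in> adjoint_process F ystar" "norm xstar \<le> r"
        using adjoint_witness_if_not_in_closure[OF K(2)] by metis
      from w(1) have "ystar \<in> sphere 0 1" by simp
      with w(2) have "?inf \<le> ennreal (norm xstar)" by (intro Inf_lower) blast
      also have "\<dots> \<le> e" using w(3) r by (simp add: ennreal_leI)
      finally show False using e(2) by simp
    qed
    from process_cover_if_dense_cover[OF K s(1) \<open>s < r\<close> this] s(1)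
    show "ennreal s \<le> ?sup" by (intro Sup_upper) auto
  qed
qed

lemma scaleR_unit_cball:
  fixes r :: real
  assumes "r > 0"
  shows "(*\<^sub>R) r ` cball (0 :: 'a::real_normed_vector) 1 = cball 0 r"
  using cball_scale[of r "0 :: 'a" 1] assms by simp

theorem proposition2p2:
  "(\<forall>(F :: 'a::metric_space \<Rightarrow> 'b::metric_space set) xbar ybar.
      (xbar, ybar) \<in> gph F \<longrightarrow>
        lopen F xbar ybar \<ge> liminf_gph F (lopen F) xbar ybar \<and>
        liminf_gph F (lopen F) xbar ybar \<ge> sur F xbar ybar)
   \<and>
   (\<forall>(F :: 'c::real_normed_vector \<Rightarrow> 'd::real_normed_vector set) xbar ybar \<alpha> \<beta>.
      (xbar, ybar) \<in> gph F \<and> locally_starshaped_graph F xbar ybar \<and>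
      \<alpha> > 0 \<and> \<beta> > 0 \<and> cball ybar \<beta> \<subseteq> (\<Union>x\<in>cball xbar \<alpha>. F x) \<longrightarrow>
        lopen F xbar ybar \<ge> ennreal (\<beta> / \<alpha>))
   \<and>
   (\<forall>(F :: 'c \<Rightarrow> 'd set) xbar ybar.
      (xbar, ybar) \<in> gph F \<and> convex (gph F) \<longrightarrow>
        lopen F xbar ybar = sur F xbar ybar)
   \<and>
   (\<forall>F :: 'e::banach \<Rightarrow> 'f::banach set.
      closed_convex_process F \<longrightarrow>
        lopen F 0 0 = sur F 0 0 \<and>
        sur F 0 0 = Sup {ennreal r | r. r > 0 \<and> (*\<^sub>R) r ` cball 0 1 \<subseteq> (\<Union>x\<in>cball 0 1. F x)} \<and>
        Sup {ennreal r | r. r > 0 \<and> (*\<^sub>R) r ` cball 0 1 \<subseteq> (\<Union>x\<in>cball 0 1. F x)} =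
          Inf {ennreal (norm xstar) | xstar. xstar \<in> (\<Union>ystar\<in>sphere 0 1. adjoint_process F ystar)})"
proof -
  have unit_balls: "{ennreal r | r. r > 0 \<and> (*\<^sub>R) r ` cball 0 1 \<subseteq> (\<Union>x\<in>cball 0 1. F x)} =
      {ennreal r | r. r > 0 \<and> cball 0 r \<subseteq> (\<Union>x\<in>cball 0 1. F x)}" for F :: "'e \<Rightarrow> 'f set"
    by (simp add: scaleR_unit_cball cong: conj_cong)
  have process: "lopen F 0 0 = sur F 0 0 \<and>
      sur F 0 0 = Sup {ennreal r | r. r > 0 \<and> (*\<^sub>R) r ` cball 0 1 \<subseteq> (\<Union>x\<in>cball 0 1. F x)} \<and>
      Sup {ennreal r | r. r > 0 \<and> (*\<^sub>R) r ` cball 0 1 \<subseteq> (\<Union>x\<in>cball 0 1. F x)} =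
        Inf {ennreal (norm xstar) | xstar. xstar \<in> (\<Union>ystar\<in>sphere 0 1. adjoint_process F ystar)}"
    if F: "closed_convex_process F" for F :: "'e \<Rightarrow> 'f set"
  proof -
    have K: "convex_cone (gph F)" using F by (simp add: closed_convex_process_def)
    have "(0, 0) \<in> gph F" using convex_cone_contains_0[OF K] by (simp add: zero_prod_def)
    moreover have "convex (gph F)" using K by (simp add: convex_cone_def)
    ultimately have "lopen F 0 0 = sur F 0 0" by (rule lopen_eq_sur_if_convex)
    then show ?thesis
      using lopen_process[OF K] Sup_cover_eq_Inf_norm_adjoint[OF F] unfolding unit_balls by simp
  qed
  show ?thesis
    using liminf_gph_lopen_le_lopen sur_le_liminf_gph_lopen lopen_ge_if_starshaped
      lopen_eq_sur_if_convex process
    by (intro conjI allI impI) blast+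
qed

end
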